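(* Let $s \ge 2$ and $n \ge 1$ be integers, and let $\mathcal{F}$ be an $s$-saturated family of subsets of $[n]$. Then $|\mathcal{F}| \ge (1 - 1/s)\,2^n$.
   Context: $[n] = \{1,\ldots,n\}$. For an integer $s \ge 2$, a family $\mathcal{F}$ of subsets of $[n]$ is called $s$-saturated if $\mathcal{F}$ contains no $s$ pairwise disjoint sets, and moreover $\mathcal{F}$ is maximal with respect to this property: for every subset $A \subseteq [n]$ with $A \notin \mathcal{F}$, the family $\mathcal{F} \cup \{A\}$ contains $s$ pairwise disjoint sets.
   Formalization: The condition s ≤ 2^n is added: for s > 2^n the only s-saturated family is all nonempty subsets of [n], of size 2^n − 1 < (1 − 1/s)2^n (e.g. n = 1, s = 3, F = {{1}}). The empty set may be repeated among s pairwise disjoint sets. *)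

theory Defs
  imports Complex_Main "HOL-Library.Disjoint_Sets"
begin

text \<open>
  \<open>s\<close> pairwise disjoint sets are an indexed family \<open>A\<^sub>1, \<dots>, A\<^sub>s\<close> of members of \<open>\<F>\<close>. Since the
  empty set is disjoint from itself, it may be repeated; two equal members are otherwise never
  disjoint. Hence a family without \<open>s\<close> pairwise disjoint sets does not contain the empty set.
  Had we asked for distinct sets, the family whose only member is the empty set would be
  2-saturated for every \<open>n\<close>.
\<close>

definition contains_disjoint :: "nat \<Rightarrow> 'a set set \<Rightarrow> bool" where
  "contains_disjoint s \<F> \<longleftrightarrow> (\<exists>A. (\<forall>i\<in>{1..s}. A i \<in> \<F>) \<and> disjoint_family_on A {1..s})"

definition saturated :: "nat \<Rightarrow> nat \<Rightarrow> nat set set \<Rightarrow> bool" where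
  "saturated s n \<F> \<longleftrightarrow>
     \<F> \<subseteq> Pow {1..n} \<and>
     \<not> contains_disjoint s \<F> \<and>
     (\<forall>A. A \<subseteq> {1..n} \<and> A \<notin> \<F> \<longrightarrow> contains_disjoint s (\<F> \<union> {A}))"

text \<open>
  For \<open>s > 2 ^ n\<close> the family of all nonempty subsets is saturated but has only
  \<open>2 ^ n - 1 < (1 - 1/s) 2 ^ n\<close> members, so the lower bound needs \<open>s \<le> 2 ^ n\<close>.
\<close>

lemma saturated_bound_fails_for_large_s:
  assumes "s > 2 ^ n"
  shows "saturated s n (Pow {1..n} - {{}})"
    and "real (card (Pow {1..n} - {{}})) < (1 - 1 / real s) * 2 ^ n"
proof -
  have "\<not> contains_disjoint s (Pow {1..n} - {{}})"
  proof
    assume "contains_disjoint s (Pow {1..n} - {{}})"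
    then obtain A where A: "\<And>i. i \<in> {1..s} \<Longrightarrow> A i \<in> Pow {1..n} - {{}}"
      and disj: "disjoint_family_on A {1..s}"
      unfolding contains_disjoint_def by blast
    have "inj_on A {1..s}"
    proof (rule inj_onI, rule ccontr)
      fix i j assume ij: "i \<in> {1..s}" "j \<in> {1..s}" "A i = A j" "i \<noteq> j"
      then have "A i \<inter> A j = {}"
        using disj unfolding disjoint_family_on_def by blast
      with ij A[of i] show False by simp
    qed
    moreover have "A ` {1..s} \<subseteq> Pow {1..n}" using A by blast
    ultimately have "card {1..s} \<le> card (Pow {1..n})"
      by (rule card_inj_on_le) simp
    with assms show False by (simp add: card_Pow)
  qed
  moreover have "contains_disjoint s (insert {} \<G>)" for \<G> :: "nat set set"
    unfolding contains_disjoint_def disjoint_family_on_def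
    by (rule exI[of _ "\<lambda>_. {}"]) simp
  ultimately show "saturated s n (Pow {1..n} - {{}})"
    unfolding saturated_def by auto
  have "card (Pow {1..n} - {{}}) = 2 ^ n - (1::nat)"
    by (simp add: card_Pow card_Diff_singleton)
  then have "real (card (Pow {1..n} - {{}})) = 2 ^ n - 1"
    by (simp add: of_nat_diff)
  moreover have "(2::real) ^ n < real s"
    using assms by (metis of_nat_less_iff of_nat_numeral of_nat_power)
  then have "2 ^ n / real s < 1"
    by (simp add: divide_less_eq)
  ultimately show "real (card (Pow {1..n} - {{}})) < (1 - 1 / real s) * 2 ^ n"
    by (simp add: algebra_simps)
qed

end

theory Submission
  imports Defs
begin

text \<open>
  Let \<open>D\<^sub>k\<close> consist of the subsets of \<open>[n]\<close> that contain \<open>k\<close> pairwise disjoint members of \<open>\<F>\<close>;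
  by saturation the complement of a nonempty non-member of \<open>\<F>\<close> lies in \<open>D\<^bsub>s-1\<^esub>\<close>, so the task is
  to show \<open>s |D\<^bsub>s-1\<^esub>| \<le> 2\<^sup>n\<close>. A disjoint-occurrence inequality in the style of van den
  Berg--Kesten and Talagrand bounds \<open>|D\<^bsub>k+1\<^esub>|\<close> by the size of
  \<open>Q = {X \<in> D\<^sub>k. [n] - X contains a member of \<F>}\<close>. The families \<open>Q\<close> and \<open>D\<^bsub>s-1\<^esub>\<close> are disjoint
  parts of \<open>D\<^sub>k\<close>, since a common element would yield \<open>s\<close> pairwise disjoint members of \<open>\<F>\<close>. Thus
  \<open>|D\<^bsub>k+1\<^esub>| + |D\<^bsub>s-1\<^esub>| \<le> |D\<^sub>k|\<close>, and summing over \<open>k < s - 1\<close>, with \<open>|D\<^sub>0| = 2\<^sup>n\<close>, gives the claim.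
\<close>

section \<open>The disjoint-occurrence inequality\<close>

lemma card_disjoint_occurrence_le:
  assumes "finite V"
  shows "card {X \<in> Pow V. \<exists>a\<in>P. \<exists>b\<in>Q. a \<subseteq> X \<and> b \<subseteq> X \<and> a \<inter> b = {}}
    \<le> card {X \<in> Pow V. (\<exists>a\<in>P. a \<subseteq> X) \<and> (\<exists>b\<in>Q. b \<subseteq> V - X)}"
proof -
  \<comment> \<open>On the coordinates in \<open>T\<close> the member of \<open>Q\<close> has to occur in the complement of \<open>X\<close>. The
    set \<open>T\<close> grows from \<open>{}\<close> to \<open>V\<close> one coordinate at a time, and the count does not drop.\<close>
  define G where "G T = {X \<in> Pow V. \<exists>a\<in>P. \<exists>b\<in>Q. a \<subseteq> X \<and> b \<subseteq> sym_diff X T \<and> a \<inter> b = {}}" for T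
  have GI: "X \<in> G T"
    if "X \<subseteq> V" "a \<in> P" "b \<in> Q" "a \<subseteq> X" "b \<subseteq> sym_diff X T" "a \<inter> b = {}" for X T a b
    using that unfolding G_def by blast
  have fin: "finite (G T)" for T
    using assms by (simp add: G_def)
  have step: "card (G T) \<le> card (G (insert i T))" if "i \<notin> T" for i T
  proof -
    \<comment> \<open>When \<open>i \<notin> X\<close>, enlarging \<open>T\<close> by
      \<open>i\<close> can only enlarge \<open>sym_diff X T\<close>, so the old witnesses
      survive.\<close>
    have keep: "X \<in> G (insert i T)" if "X \<in> G T" "i \<notin> X" for X
    proof -
      from that(1) obtain a b where *: "X \<subseteq> V" "a \<in> P" "b \<in> Q" "a \<subseteq> X" "b \<subseteq> sym_diff X T" "a \<inter> b = {}"
        unfolding G_def by blast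
      have "b \<subseteq> sym_diff X (insert i T)"
        using *(5) that(2) by blast
      then show ?thesis by (rule GI[OF *(1,2,3,4) _ *(6)])
    qed
    \<comment> \<open>Witnesses are lost only if \<open>b\<close> uses \<open>i\<close>. Then
      \<open>a\<close> avoids \<open>i\<close>, and deleting \<open>i\<close> from \<open>X\<close>
      makes it available to \<open>b\<close> in the new symmetric difference.\<close>
    have flip: "X - {i} \<in> G (insert i T)" if "X \<in> G T" "X \<notin> G (insert i T)" for X
    proof -
      from that(1) obtain a b where *: "X \<subseteq> V" "a \<in> P" "b \<in> Q" "a \<subseteq> X" "b \<subseteq> sym_diff X T" "a \<inter> b = {}"
        unfolding G_def by blast
      have "i \<in> b"
      proof (rule ccontr)
        assume "i \<notin> b"
        then have "b \<subseteq> sym_diff X (insert i T)" using *(5) by blast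
        then have "X \<in> G (insert i T)" by (rule GI[OF *(1,2,3,4) _ *(6)])
        with that(2) show False ..
      qed
      then have "a \<subseteq> X - {i}"
        using *(4,6) by blast
      moreover have "b \<subseteq> sym_diff (X - {i}) (insert i T)"
        using *(5) \<open>i \<notin> T\<close> by blast
      moreover have "X - {i} \<subseteq> V" using *(1) by blast
      ultimately show ?thesis by (intro GI[OF _ *(2,3) _ _ *(6)])
    qed
    \<comment> \<open>As \<open>i \<notin> T\<close>, neither witness for \<open>X - {i}\<close>
      uses \<open>i\<close>, so both also serve \<open>X\<close>.\<close>
    have clash: "X \<in> G (insert i T)" if "X \<in> G T" "X - {i} \<in> G T" for X
    proof -
      from that(2) obtain a b where *: "a \<in> P" "b \<in> Q" "a \<subseteq> X - {i}"
          "b \<subseteq> sym_diff (X - {i}) T" "a \<inter> b = {}"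
        unfolding G_def by blast
      have "b \<subseteq> sym_diff X (insert i T)"
        using *(4) \<open>i \<notin> T\<close> by blast
      moreover have "X \<subseteq> V" using that(1) unfolding G_def by blast
      moreover have "a \<subseteq> X" using *(3) by blast
      ultimately show ?thesis by (intro GI[OF _ *(1,2) _ _ *(5)])
    qed
    \<comment> \<open>Delete \<open>i\<close> only when forced. By \<open>clash\<close> the result
      then lies outside \<open>G T\<close>, so it differs from every kept set; by
      \<open>keep\<close> every altered set contained \<open>i\<close>, so the deletion can be
      undone.\<close>
    define h where "h X = (if X \<in> G (insert i T) then X else X - {i})" for X
    have "inj_on h (G T)"
    proof (rule inj_onI)
      fix X Y assume XY: "X \<in> G T" "Y \<in> G T" and eq: "h X = h Y"
      consider "X = Y" | "X - {i} = Y" "X \<notin> G (insert i T)" | "X = Y - {i}" "Y \<notin> G (insert i T)"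
        | "X - {i} = Y - {i}" "X \<notin> G (insert i T)" "Y \<notin> G (insert i T)"
        using eq unfolding h_def by (auto split: if_splits)
      then show "X = Y"
      proof cases
        case 4
        then have "i \<in> X" "i \<in> Y" using keep XY by blast+
        with 4 show ?thesis by blast
      qed (use clash XY in auto)
    qed
    moreover have "h ` G T \<subseteq> G (insert i T)"
      using flip unfolding h_def by auto
    ultimately show ?thesis by (rule card_inj_on_le) (rule fin)
  qed
  have "card (G {}) \<le> card (G T)" if "T \<subseteq> V" for T
    using finite_subset[OF that assms] that
  proof (induction T rule: finite_induct)
    case (insert i T)
    then show ?case using step[of i T] by simp
  qed simp
  from this[OF subset_refl] have "card (G {}) \<le> card (G V)" .
  moreover have "G {} = {X \<in> Pow V. \<exists>a\<in>P. \<exists>b\<in>Q. a \<subseteq> X \<and> b \<subseteq> X \<and> a \<inter> b = {}}"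
    unfolding G_def by simp
  moreover have "G V \<subseteq> {X \<in> Pow V. (\<exists>a\<in>P. a \<subseteq> X) \<and> (\<exists>b\<in>Q. b \<subseteq> V - X)}"
  proof
    fix X assume "X \<in> G V"
    then obtain a b where "X \<subseteq> V" "a \<in> P" "b \<in> Q" "a \<subseteq> X" "b \<subseteq> sym_diff X V"
      unfolding G_def by blast
    moreover from \<open>X \<subseteq> V\<close> have "sym_diff X V = V - X" by blast
    ultimately show "X \<in> {X \<in> Pow V. (\<exists>a\<in>P. a \<subseteq> X) \<and> (\<exists>b\<in>Q. b \<subseteq> V - X)}" by auto
  qed
  then have "card (G V) \<le> card {X \<in> Pow V. (\<exists>a\<in>P. a \<subseteq> X) \<and> (\<exists>b\<in>Q. b \<subseteq> V - X)}"
    by (rule card_mono[rotated]) (use assms in simp)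
  ultimately show ?thesis by simp
qed

section \<open>Indexed families of pairwise disjoint members\<close>

lemma contains_disjointI:
  assumes "finite I" "card I = k" "\<And>i. i \<in> I \<Longrightarrow> A i \<in> \<F>" "disjoint_family_on A I"
  shows "contains_disjoint k \<F>"
proof -
  obtain h where h: "bij_betw h {1..k} I"
    using ex_bij_betw_nat_finite_1[OF assms(1)] assms(2) by blast
  then have "disjoint_family_on (A \<circ> h) {1..k}"
    using assms(4) unfolding disjoint_family_on_def bij_betw_def inj_on_def by fastforce
  moreover have "\<forall>i\<in>{1..k}. (A \<circ> h) i \<in> \<F>"
    using h assms(3) by (auto dest: bij_betwE)
  ultimately show ?thesis unfolding contains_disjoint_def by blast
qed

lemma contains_disjoint_0 [simp]: "contains_disjoint 0 \<F>"
  by (simp add: contains_disjoint_def disjoint_family_on_def)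

lemma contains_disjoint_mono:
  assumes "contains_disjoint k \<F>" "\<F> \<subseteq> \<G>" "j \<le> k"
  shows "contains_disjoint j \<G>"
proof -
  from assms(1) obtain A where "\<forall>i\<in>{1..k}. A i \<in> \<F>" "disjoint_family_on A {1..k}"
    unfolding contains_disjoint_def by blast
  moreover have "{1..j} \<subseteq> {1..k}" using assms(3) by simp
  ultimately have "(\<forall>i\<in>{1..j}. A i \<in> \<G>) \<and> disjoint_family_on A {1..j}"
    using assms(2) disjoint_family_on_mono by blast
  then show ?thesis unfolding contains_disjoint_def by blast
qed

text \<open>Splits off the last index. Restricting to \<open>Pow X\<close> makes the recursion close
  up: the members inside \<open>X\<close> that avoid \<open>a\<close> are those inside
  \<open>X - a\<close>.\<close>

lemma contains_disjoint_Suc: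
  "contains_disjoint (Suc k) (\<F> \<inter> Pow X) \<longleftrightarrow>
    (\<exists>a\<in>\<F>. a \<subseteq> X \<and> contains_disjoint k (\<F> \<inter> Pow (X - a)))"
proof
  assume "contains_disjoint (Suc k) (\<F> \<inter> Pow X)"
  then obtain A where A: "\<forall>i\<in>{1..Suc k}. A i \<in> \<F> \<inter> Pow X" "disjoint_family_on A {1..Suc k}"
    unfolding contains_disjoint_def by blast
  have "A i \<in> \<F> \<inter> Pow (X - A (Suc k))" if "i \<in> {1..k}" for i
  proof -
    have "A i \<inter> A (Suc k) = {}"
      using A(2) that by (intro disjoint_family_onD) auto
    then show ?thesis using A(1) that by fastforce
  qed
  moreover have "disjoint_family_on A {1..k}"
    using A(2) by (rule disjoint_family_on_mono[rotated]) auto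
  ultimately have "contains_disjoint k (\<F> \<inter> Pow (X - A (Suc k)))"
    unfolding contains_disjoint_def by blast
  then show "\<exists>a\<in>\<F>. a \<subseteq> X \<and> contains_disjoint k (\<F> \<inter> Pow (X - a))"
    using A(1) by (intro bexI[of _ "A (Suc k)"]) auto
next
  assume "\<exists>a\<in>\<F>. a \<subseteq> X \<and> contains_disjoint k (\<F> \<inter> Pow (X - a))"
  then obtain a A where a: "a \<in> \<F>" "a \<subseteq> X"
    and A: "\<forall>i\<in>{1..k}. A i \<in> \<F> \<inter> Pow (X - a)" "disjoint_family_on A {1..k}"
    unfolding contains_disjoint_def by blast
  define B where "B = A(Suc k := a)"
  have "\<forall>i\<in>{1..Suc k}. B i \<in> \<F> \<inter> Pow X"
    using a A(1) by (fastforce simp: B_def le_Suc_eq)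
  moreover have "disjoint_family_on B (insert (Suc k) {1..k})"
    using A by (fastforce simp: B_def disjoint_family_on_def)
  then have "disjoint_family_on B {1..Suc k}"
    by (simp add: atLeastAtMostSuc_conv)
  ultimately show "contains_disjoint (Suc k) (\<F> \<inter> Pow X)"
    unfolding contains_disjoint_def by blast
qed

section \<open>The families \<open>D\<^sub>k\<close>, here \<open>packing_sets V \<F> k\<close>, and
  their sizes\<close>

definition packing_sets :: "'a set \<Rightarrow> 'a set set \<Rightarrow> nat \<Rightarrow> 'a set set" where
  "packing_sets V \<F> k = {X \<in> Pow V. contains_disjoint k (\<F> \<inter> Pow X)}"

lemma finite_packing_sets [simp]: "finite V \<Longrightarrow> finite (packing_sets V \<F> k)"
  by (simp add: packing_sets_def)

lemma card_packing_sets_Suc: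
  assumes "finite V" "\<not> contains_disjoint (Suc m) \<F>" "k \<le> m"
  shows "card (packing_sets V \<F> (Suc k)) + card (packing_sets V \<F> m) \<le> card (packing_sets V \<F> k)"
proof -
  let ?D = "packing_sets V \<F>"
  define Q where "Q = {X \<in> Pow V. (\<exists>a\<in>?D k. a \<subseteq> X) \<and> (\<exists>b\<in>\<F>. b \<subseteq> V - X)}"
  \<comment> \<open>Once a member \<open>b\<close> is split off, all of \<open>X - b\<close> serves
    as the disjoint witness from \<open>?D k\<close>.\<close>
  have "?D (Suc k) \<subseteq> {X \<in> Pow V. \<exists>a\<in>?D k. \<exists>b\<in>\<F>. a \<subseteq> X \<and> b \<subseteq> X \<and> a \<inter> b = {}}"
  proof
    fix X assume "X \<in> ?D (Suc k)"
    then obtain b where b: "X \<subseteq> V" "b \<in> \<F>" "b \<subseteq> X" "contains_disjoint k (\<F> \<inter> Pow (X - b))"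
      unfolding packing_sets_def contains_disjoint_Suc by blast
    then have "X - b \<in> ?D k" unfolding packing_sets_def by blast
    moreover have "X - b \<subseteq> X" "(X - b) \<inter> b = {}" by blast+
    ultimately show "X \<in> {X \<in> Pow V. \<exists>a\<in>?D k. \<exists>b\<in>\<F>. a \<subseteq> X \<and> b \<subseteq> X \<and> a \<inter> b = {}}"
      using b(1,2,3) by (intro CollectI conjI bexI[of _ "X - b"] bexI[of _ b]) auto
  qed
  then have "card (?D (Suc k)) \<le> card {X \<in> Pow V. \<exists>a\<in>?D k. \<exists>b\<in>\<F>. a \<subseteq> X \<and> b \<subseteq> X \<and> a \<inter> b = {}}"
    by (rule card_mono[rotated]) (use assms(1) in simp)
  also have "\<dots> \<le> card Q"
    unfolding Q_def by (rule card_disjoint_occurrence_le[OF assms(1)])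
  finally have 1: "card (?D (Suc k)) \<le> card Q" .
  have "Q \<inter> ?D m = {}"
  proof (rule ccontr)
    assume "Q \<inter> ?D m \<noteq> {}"
    then obtain X b where X: "X \<subseteq> V" "b \<in> \<F>" "b \<subseteq> V - X" "contains_disjoint m (\<F> \<inter> Pow X)"
      unfolding Q_def packing_sets_def by blast
    then have "contains_disjoint m (\<F> \<inter> Pow (V - b))"
      by (elim contains_disjoint_mono) auto
    with X have "contains_disjoint (Suc m) (\<F> \<inter> Pow V)"
      unfolding contains_disjoint_Suc by blast
    then have "contains_disjoint (Suc m) \<F>"
      by (rule contains_disjoint_mono) auto
    with assms(2) show False by simp
  qed
  moreover have "finite Q" using assms(1) by (simp add: Q_def)
  ultimately have "card Q + card (?D m) = card (Q \<union> ?D m)"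
    using assms(1) by (simp add: card_Un_disjoint)
  moreover have "Q \<union> ?D m \<subseteq> ?D k"
  proof -
    have "Q \<subseteq> ?D k"
    proof
      fix X assume "X \<in> Q"
      then obtain a where "X \<subseteq> V" "a \<subseteq> X" "contains_disjoint k (\<F> \<inter> Pow a)"
        unfolding Q_def packing_sets_def by blast
      moreover from this have "contains_disjoint k (\<F> \<inter> Pow X)"
        by (elim contains_disjoint_mono) auto
      ultimately show "X \<in> ?D k" unfolding packing_sets_def by blast
    qed
    moreover have "?D m \<subseteq> ?D k"
      using assms(3) contains_disjoint_mono unfolding packing_sets_def by blast
    ultimately show ?thesis by simp
  qed
  then have "card (Q \<union> ?D m) \<le> card (?D k)"
    by (rule card_mono[rotated]) (use assms(1) in simp)
  ultimately show ?thesis using 1 by linarith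
qed

lemma card_packing_sets_le:
  assumes "finite V" "\<not> contains_disjoint (Suc m) \<F>"
  shows "Suc m * card (packing_sets V \<F> m) \<le> 2 ^ card V"
proof -
  \<comment> \<open>The partial sums telescope; \<open>k = m\<close> adds one more copy to the
    \<open>m\<close> collected, hence the factor \<open>Suc m\<close>.\<close>
  have "card (packing_sets V \<F> k) + k * card (packing_sets V \<F> m) \<le> 2 ^ card V" if "k \<le> m" for k
    using that
  proof (induction k)
    case 0
    have "packing_sets V \<F> 0 = Pow V" by (auto simp: packing_sets_def)
    then show ?case using assms(1) by (simp add: card_Pow)
  next
    case (Suc k)
    then show ?case using card_packing_sets_Suc[OF assms, of k] by simp
  qed
  from this[of m] show ?thesis by simp
qed

section \<open>Saturation and the sets missing from \<open>\<F>\<close>\<close>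

lemma contains_disjoint_insertD:
  assumes "contains_disjoint (Suc m) (insert A \<F>)" "\<not> contains_disjoint (Suc m) \<F>" "A \<noteq> {}"
  shows "contains_disjoint m (\<F> \<inter> Pow (- A))"
proof -
  from assms(1) obtain B where B: "\<forall>i\<in>{1..Suc m}. B i \<in> insert A \<F>" "disjoint_family_on B {1..Suc m}"
    unfolding contains_disjoint_def by blast
  with assms(2) obtain i where i: "i \<in> {1..Suc m}" "B i = A"
    unfolding contains_disjoint_def by blast
  show ?thesis
  \<comment> \<open>Dropping \<open>i\<close> may leave a gap in the indices, which this rule
    renumbers. The other sets are disjoint from the nonempty \<open>A\<close>, hence differ from it
    and come from \<open>\<F>\<close>.\<close>
  proof (rule contains_disjointI)
    show "card ({1..Suc m} - {i}) = m" using i by simp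
    show "disjoint_family_on B ({1..Suc m} - {i})"
      using B(2) by (rule disjoint_family_on_mono[rotated]) auto
    fix j assume j: "j \<in> {1..Suc m} - {i}"
    then have "B j \<inter> A = {}"
      using disjoint_family_onD[OF B(2), of j i] i by auto
    then show "B j \<in> \<F> \<inter> Pow (- A)"
      using B(1) j assms(3) by auto
  qed simp
qed

theorem theorem1p4:
  fixes s n :: nat and \<F> :: "nat set set"
  assumes "s \<ge> 2" and "n \<ge> 1" and "s \<le> 2 ^ n"
    and "saturated s n \<F>"
  shows "real (card \<F>) \<ge> (1 - 1 / real s) * 2 ^ n"
proof -
  obtain m where m: "s = Suc m" using assms(1) by (cases s) auto
  define V where "V = {1..n}"
  let ?D = "packing_sets V \<F> m"
  have V: "finite V" "card V = n" by (simp_all add: V_def)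
  have sub: "\<F> \<subseteq> Pow V" and nd: "\<not> contains_disjoint (Suc m) \<F>"
    and sat: "\<And>A. A \<subseteq> V \<Longrightarrow> A \<notin> \<F> \<Longrightarrow> contains_disjoint (Suc m) (insert A \<F>)"
    using assms(4) unfolding saturated_def m V_def by auto
  have compl: "V - A \<in> ?D" if "A \<in> Pow V - \<F>" "A \<noteq> {}" for A
  proof -
    have "contains_disjoint m (\<F> \<inter> Pow (- A))"
      using contains_disjoint_insertD[OF sat nd] that by blast
    moreover have "\<F> \<inter> Pow (- A) = \<F> \<inter> Pow (V - A)" using sub by blast
    ultimately show ?thesis unfolding packing_sets_def by simp
  qed
  have missing: "s * card (Pow V - \<F>) \<le> 2 ^ n"
  proof (cases "?D = {}")
    case True
    \<comment> \<open>The empty set may be missing from \<open>\<F>\<close> without \<open>V\<close> lying in \<open>?D\<close>: repeated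
      empty sets already violate the condition.\<close>
    then have "A = {}" if "A \<in> Pow V - \<F>" for A using compl[OF that] by (cases "A = {}") auto
    then have "Pow V - \<F> \<subseteq> {{}}" by (intro subsetI) simp
    then have "card (Pow V - \<F>) \<le> 1" using card_mono[of "{{}}" "Pow V - \<F>"] by simp
    then have "s * card (Pow V - \<F>) \<le> s * 1" by (rule mult_le_mono2)
    \<comment> \<open>The bound \<open>s \<le> 2 ^ n\<close> pays for the one set that may be
      missing.\<close>
    with assms(3) show ?thesis by linarith
  next
    case False
    \<comment> \<open>A nonempty \<open>?D\<close> contains \<open>V\<close> by upward closure, so
      complementation sends even a missing empty set into \<open>?D\<close>.\<close>
    then obtain X where "X \<subseteq> V" "contains_disjoint m (\<F> \<inter> Pow X)"
      unfolding packing_sets_def by blast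
    then have "contains_disjoint m (\<F> \<inter> Pow V)"
      by (elim contains_disjoint_mono) auto
    then have "V \<in> ?D" unfolding packing_sets_def by simp
    then have "V - A \<in> ?D" if "A \<in> Pow V - \<F>" for A using compl[OF that] by (cases "A = {}") simp_all
    then have "(-) V ` (Pow V - \<F>) \<subseteq> ?D" by (rule image_subsetI)
    moreover have "inj_on ((-) V) (Pow V - \<F>)" by (rule inj_onI) blast
    ultimately have "card (Pow V - \<F>) \<le> card ?D"
      using V by (intro card_inj_on_le) auto
    then have "s * card (Pow V - \<F>) \<le> s * card ?D" by (rule mult_le_mono2)
    also have "\<dots> \<le> 2 ^ n" using card_packing_sets_le[OF V(1) nd] V m by simp
    finally show ?thesis .
  qed
  have "card \<F> + card (Pow V - \<F>) = 2 ^ n"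
    using card_Un_disjoint[of \<F> "Pow V - \<F>"] sub V finite_subset[OF sub]
    by (simp add: card_Pow Un_absorb1)
  then have "real (card \<F>) + real (card (Pow V - \<F>)) = 2 ^ n"
    by (metis of_nat_add of_nat_numeral of_nat_power)
  then have "real (card (Pow V - \<F>)) = 2 ^ n - real (card \<F>)" by simp
  moreover have "real s * real (card (Pow V - \<F>)) \<le> 2 ^ n"
    using missing by (metis of_nat_le_iff of_nat_mult of_nat_numeral of_nat_power)
  ultimately have "real s * (2 ^ n - real (card \<F>)) \<le> 2 ^ n" by simp
  moreover have "real s > 0" using assms(1) by simp
  ultimately show ?thesis by (simp add: field_simps)
qed

end
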